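(* Let $s03'$ be the nine-dimensional unital $\mathbb{C}$-algebra defined in the context and consider its left regular representation (LRR). Then: (1) The subspace spanned by $\tilde D,\tilde D^2,\tilde B\tilde D,\tilde D\tilde C$ is a subrepresentation which is the direct sum of two two-dimensional irreducible representations, spanned respectively by $$v^1_0=\tilde D+\tilde D^2,\ v^1_1=\tilde B\tilde D+\tilde D\tilde C\qquad\text{and}\qquad v^2_0=\tilde B\tilde D-\tilde D\tilde C,\ v^2_1=\tilde D-\tilde D^2 ,$$ on which, for $k=1,2$, $$\tilde Bv^k_0=v^k_1,\ \tilde Bv^k_1=v^k_0,\quad \tilde Cv^k_0=-v^k_1,\ \tilde Cv^k_1=v^k_0,\quad \tilde Dv^k_0=v^k_0,\ \tilde Dv^k_1=-v^k_1 .$$ These two irreducible representations are isomorphic via $(v^1_0,v^1_1)\mapsto(v^2_0,v^2_1)$, and $\tilde B^2$ and $\tilde D^2$ act on them as $1$. (2) The vector $\tilde B^2-1$ spans a trivial one-dimensional subrepresentation (all of $\tilde B,\tilde C,\tilde D$ act by zero). (3) The quotient of the LRR by the sum of the three subrepresentations in (1) and (2) is the direct sum of four one-dimensional representations, spanned by the classes of $$v_{\epsilon,\epsilon'}=\tilde B+\epsilon 1-i\epsilon\epsilon'\tilde C-i\epsilon'\tilde B\tilde C,\qquad \epsilon,\epsilon'\in\{+1,-1\},$$ with action $\tilde Bv_{\epsilon,\epsilon'}=\epsilon v_{\epsilon,\epsilon'}$, $\tilde Cv_{\epsilon,\epsilon'}=i\epsilon'v_{\epsilon,\epsilon'}$,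 $\tilde Dv_{\epsilon,\epsilon'}=0$; these four representations are pairwise non-isomorphic, and $\tilde B^2,\tilde D^2$ take the values $1,0$ on them.
   Context: $s03'$ is the unital associative $\mathbb{C}$-algebra generated by $\tilde B,\tilde C,\tilde D$ with relations $\tilde D^3=\tilde B^2\tilde D=\tilde D\tilde B^2=\tilde D$; $\tilde B\tilde C-\tilde C\tilde B=-2\tilde D$; $\tilde D\tilde B=-\tilde B\tilde D=\tilde C\tilde D^2=\tilde D^2\tilde C$; $\tilde C\tilde D+\tilde D\tilde C=0$; $\tilde B^2+\tilde C^2=0$; $\tilde B^3=\tilde B$; $\tilde C^3=-\tilde C$. It has the nine-element basis $1,\tilde B,\tilde C,\tilde D,\tilde B\tilde C,\tilde B\tilde D,\tilde D\tilde C,\tilde B^2,\tilde D^2$. The left regular representation is the action of the algebra on itself by left multiplication. *)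

theory Defs
  imports Complex_Main "HOL-Library.FuncSet" "HOL-Library.Poly_Mapping"
begin

section \<open>Algebras and representations over the complex numbers\<close>

locale complex_algebra = vector_space scale
  for scale :: "complex \<Rightarrow> 'a::ring_1 \<Rightarrow> 'a" +
  assumes scale_mult_left: "scale c x * y = scale c (x * y)"
    and scale_mult_right: "x * scale c y = scale c (x * y)"

locale algebra_rep = alg: complex_algebra scaleA + vector_space scale
  for scaleA :: "complex \<Rightarrow> 'a::ring_1 \<Rightarrow> 'a"
    and scale :: "complex \<Rightarrow> 'v::ab_group_add \<Rightarrow> 'v" +
  fixes act :: "'a \<Rightarrow> 'v \<Rightarrow> 'v"
  assumes act_add_right: "act a (u + v) = act a u + act a v"
    and act_scale_right: "act a (scale c v) = scale c (act a v)"
    and act_add_left: "act (a + b) v = act a v + act b v"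
    and act_scale_left: "act (scaleA c a) v = scale c (act a v)"
    and act_one: "act 1 v = v"
    and act_mult: "act (a * b) v = act a (act b v)"
begin

definition subrep :: "'v set \<Rightarrow> bool" where
  "subrep U \<longleftrightarrow> subspace U \<and> (\<forall>a. \<forall>u\<in>U. act a u \<in> U)"

definition irreducible :: "'v set \<Rightarrow> bool" where
  "irreducible U \<longleftrightarrow> subrep U \<and> U \<noteq> {0} \<and>
     (\<forall>W. subrep W \<and> W \<subseteq> U \<longrightarrow> W = {0} \<or> W = U)"

text \<open>Internal direct sum: every element of \<open>U\<close> is a sum of components from the
  subrepresentations \<open>F i\<close> in exactly one way.\<close>

definition direct_sum :: "'i set \<Rightarrow> ('i \<Rightarrow> 'v set) \<Rightarrow> 'v set \<Rightarrow> bool" where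
  "direct_sum I F U \<longleftrightarrow> finite I \<and> (\<forall>i\<in>I. subrep (F i)) \<and>
     bij_betw (\<lambda>f. \<Sum>i\<in>I. f i) (PiE I F) U"

definition subrep_iso :: "('v \<Rightarrow> 'v) \<Rightarrow> 'v set \<Rightarrow> 'v set \<Rightarrow> bool" where
  "subrep_iso f U U' \<longleftrightarrow> subrep U \<and> subrep U' \<and> bij_betw f U U' \<and>
     (\<forall>u\<in>U. \<forall>v\<in>U. f (u + v) = f u + f v) \<and>
     (\<forall>c. \<forall>u\<in>U. f (scale c u) = scale c (f u)) \<and>
     (\<forall>a. \<forall>u\<in>U. f (act a u) = act a (f u))"

definition isomorphic :: "'v set \<Rightarrow> 'v set \<Rightarrow> bool" where
  "isomorphic U U' \<longleftrightarrow> (\<exists>f. subrep_iso f U U')"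

end


section \<open>Algebras presented by generators and relations\<close>

text \<open>Lists under concatenation are the free monoid, so \<open>'g list \<Rightarrow>\<^sub>0 complex\<close>, whose
  product is convolution, is the free unital associative algebra on \<open>'g\<close>.\<close>

instantiation list :: (type) monoid_add
begin
definition zero_list :: "'a list" where "zero_list = []"
definition plus_list :: "'a list \<Rightarrow> 'a list \<Rightarrow> 'a list" where "plus_list = append"
instance by standard (simp_all add: zero_list_def plus_list_def)
end

type_synonym 'g free_alg = "'g list \<Rightarrow>\<^sub>0 complex"

definition gen :: "'g \<Rightarrow> 'g free_alg" where
  "gen g = Poly_Mapping.single [g] 1"

inductive_set two_sided_ideal :: "'a::ring_1 set \<Rightarrow> 'a set" for S where
  zero: "0 \<in> two_sided_ideal S"
| generator: "s \<in> S \<Longrightarrow> a * s * b \<in> two_sided_ideal S"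
| add: "x \<in> two_sided_ideal S \<Longrightarrow> y \<in> two_sided_ideal S \<Longrightarrow> x + y \<in> two_sided_ideal S"

lemma two_sided_ideal_mult:
  assumes "x \<in> two_sided_ideal S"
  shows "a * x * b \<in> two_sided_ideal S"
  using assms
proof induction
  case zero
  then show ?case by (simp add: two_sided_ideal.zero)
next
  case (generator s c d)
  have "a * (c * s * d) * b = (a * c) * s * (d * b)"
    by (simp add: mult.assoc)
  then show ?case using two_sided_ideal.generator[OF generator] by metis
next
  case (add x y)
  then show ?case by (simp add: distrib_left distrib_right two_sided_ideal.add)
qed

lemma two_sided_ideal_mult_left: "x \<in> two_sided_ideal S \<Longrightarrow> a * x \<in> two_sided_ideal S"
  using two_sided_ideal_mult[of x S a 1] by simp

lemma two_sided_ideal_mult_right: "x \<in> two_sided_ideal S \<Longrightarrow> x * b \<in> two_sided_ideal S"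
  using two_sided_ideal_mult[of x S 1 b] by simp

lemma two_sided_ideal_uminus: "x \<in> two_sided_ideal S \<Longrightarrow> - x \<in> two_sided_ideal S"
  using two_sided_ideal_mult_left[of x S "-1"] by simp

lemma two_sided_ideal_diff:
  "x \<in> two_sided_ideal S \<Longrightarrow> y \<in> two_sided_ideal S \<Longrightarrow> x - y \<in> two_sided_ideal S"
  using two_sided_ideal.add[of x S "- y"] two_sided_ideal_uminus by fastforce


section \<open>The algebra s03'\<close>

datatype s03_gen = GB | GC | GD

definition s03_relations :: "(s03_gen free_alg \<times> s03_gen free_alg) set" where
  "s03_relations =
    (let B = gen GB; C = gen GC; D = gen GD in
      {(D^3, D), (B^2 * D, D), (D * B^2, D),
       (B * C - C * B, - 2 * D),
       (D * B, - B * D), (- B * D, C * D^2), (C * D^2, D^2 * C),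
       (C * D + D * C, 0),
       (B^2 + C^2, 0),
       (B^3, B), (C^3, - C)})"

definition s03_ideal :: "s03_gen free_alg set" where
  "s03_ideal = two_sided_ideal {l - r | l r. (l, r) \<in> s03_relations}"

quotient_type s03 = "s03_gen free_alg" / "\<lambda>x y. x - y \<in> s03_ideal"
proof (rule equivpI)
  show "reflp (\<lambda>x y. x - y \<in> s03_ideal)"
    by (simp add: reflp_def s03_ideal_def two_sided_ideal.zero)
  show "symp (\<lambda>x y. x - y \<in> s03_ideal)"
    unfolding symp_def s03_ideal_def using two_sided_ideal_uminus by fastforce
  show "transp (\<lambda>x y. x - y \<in> s03_ideal)"
    unfolding transp_def s03_ideal_def
  proof (intro allI impI)
    fix x y z :: "s03_gen free_alg"
    let ?I = "two_sided_ideal {l - r | l r. (l, r) \<in> s03_relations}"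
    assume "x - y \<in> ?I" "y - z \<in> ?I"
    then have "(x - y) + (y - z) \<in> ?I" by (rule two_sided_ideal.add)
    then show "x - z \<in> ?I" by simp
  qed
qed

text \<open>Nondegeneracy, required by the class \<open>ring_1\<close>: the relators, hence all elements of
  the ideal, have zero constant coefficient.\<close>

lemma update_eq_add_single:
  fixes p :: "'g free_alg"
  assumes "w \<notin> Poly_Mapping.keys p"
  shows "Poly_Mapping.update w c p = p + Poly_Mapping.single w c"
proof (rule poly_mapping_eqI)
  fix k
  show "poly_mapping.lookup (Poly_Mapping.update w c p) k
      = poly_mapping.lookup (p + Poly_Mapping.single w c) k"
    using assms by (cases "k = w")
      (simp_all add: update.rep_eq lookup_add lookup_single_not_eq in_keys_iff)
qed

lemma free_alg_induct [case_names single add]: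
  fixes p :: "'g free_alg"
  assumes "\<And>w c. P (Poly_Mapping.single w c)"
    and "\<And>p q. P p \<Longrightarrow> P q \<Longrightarrow> P (p + q)"
  shows "P p"
proof (induction p rule: update_induct)
  case const
  show ?case using assms(1)[of "[]" 0] by (simp only: single_zero)
next
  case (update p w c)
  show ?case unfolding update_eq_add_single[OF update(1)]
    by (intro assms update)
qed

lemma lookup_Nil_mult:
  fixes p q :: "'g free_alg"
  shows "poly_mapping.lookup (p * q) [] = poly_mapping.lookup p [] * poly_mapping.lookup q []"
proof (induction p rule: free_alg_induct)
  case (single w c)
  show ?case
  proof (induction q rule: free_alg_induct)
    case (single v d)
    show ?case
      by (cases "w = []"; cases "v = []")
        (simp_all add: mult_single lookup_single_not_eq plus_list_def)
  next
    case (add q r)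
    then show ?case by (simp add: distrib_left lookup_add)
  qed
next
  case (add p r)
  then show ?case by (simp add: distrib_right lookup_add)
qed

lemma s03_ideal_lookup_Nil:
  assumes "x \<in> s03_ideal"
  shows "poly_mapping.lookup x [] = 0"
  using assms unfolding s03_ideal_def
proof induction
  case (generator s a b)
  have "poly_mapping.lookup (gen g) [] = 0" for g :: s03_gen
    by (simp add: gen_def lookup_single)
  with generator have "poly_mapping.lookup s [] = 0"
    by (auto simp: s03_relations_def Let_def lookup_minus lookup_add lookup_Nil_mult
        power2_eq_square power3_eq_cube)
  then show ?case by (simp add: lookup_Nil_mult)
qed (simp_all add: lookup_add)

instantiation s03 :: ring_1
begin

lift_definition zero_s03 :: s03 is 0 .
lift_definition one_s03 :: s03 is 1 .
lift_definition plus_s03 :: "s03 \<Rightarrow> s03 \<Rightarrow> s03" is "(+)"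
  unfolding s03_ideal_def by (simp only: add_diff_add two_sided_ideal.add)
lift_definition uminus_s03 :: "s03 \<Rightarrow> s03" is uminus
  unfolding s03_ideal_def by (simp only: minus_diff_minus two_sided_ideal_uminus)
lift_definition minus_s03 :: "s03 \<Rightarrow> s03 \<Rightarrow> s03" is "(-)"
proof -
  fix a b c d :: "s03_gen free_alg"
  assume "a - b \<in> s03_ideal" "c - d \<in> s03_ideal"
  then have "(a - b) - (c - d) \<in> s03_ideal"
    unfolding s03_ideal_def by (rule two_sided_ideal_diff)
  then show "(a - c) - (b - d) \<in> s03_ideal"
    by (simp add: algebra_simps)
qed
lift_definition times_s03 :: "s03 \<Rightarrow> s03 \<Rightarrow> s03" is "(*)"
proof -
  fix a b c d :: "s03_gen free_alg"
  assume "a - b \<in> s03_ideal" "c - d \<in> s03_ideal"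
  then have "(a - b) * c + b * (c - d) \<in> s03_ideal"
    unfolding s03_ideal_def
    by (intro two_sided_ideal.add two_sided_ideal_mult_left two_sided_ideal_mult_right)
  then show "a * c - b * d \<in> s03_ideal"
    by (simp add: algebra_simps)
qed

instance
proof
  show "(0::s03) \<noteq> 1"
  proof transfer
    show "0 - 1 \<notin> s03_ideal"
      using s03_ideal_lookup_Nil[of "0 - 1"]
      by (auto simp: lookup_minus lookup_one zero_list_def when_def)
  qed
qed (transfer; simp add: s03_ideal_def two_sided_ideal.zero algebra_simps)+

end

lift_definition s03_scale :: "complex \<Rightarrow> s03 \<Rightarrow> s03" is "\<lambda>c. Poly_Mapping.map ((*) c)"
proof -
  fix c and x y :: "s03_gen free_alg"
  assume "x - y \<in> s03_ideal"
  then have "Poly_Mapping.single 0 c * (x - y) \<in> s03_ideal"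
    unfolding s03_ideal_def by (rule two_sided_ideal_mult_left)
  then show "Poly_Mapping.map ((*) c) x - Poly_Mapping.map ((*) c) y \<in> s03_ideal"
    by (simp add: mult_map_scale_conv_mult algebra_simps)
qed

lift_definition Bt :: s03 is "gen GB" .
lift_definition Ct :: s03 is "gen GC" .
lift_definition Dt :: s03 is "gen GD" .

lemma single_Nil_commute:
  fixes p :: "'g free_alg"
  shows "p * Poly_Mapping.single 0 c = Poly_Mapping.single 0 c * p"
  by (induction p rule: free_alg_induct) (simp_all add: mult_single distrib_left distrib_right mult.commute)

lemma s03_zeroI: "0 \<in> s03_ideal"
  by (simp add: s03_ideal_def two_sided_ideal.zero)

interpretation s03: complex_algebra s03_scale
proof
  fix c d :: complex and x y :: s03
  show "s03_scale c (x + y) = s03_scale c x + s03_scale c y"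
    by transfer (simp add: mult_map_scale_conv_mult distrib_left s03_zeroI)
  show "s03_scale (c + d) x = s03_scale c x + s03_scale d x"
    by transfer (simp add: mult_map_scale_conv_mult distrib_right single_add s03_zeroI)
  show "s03_scale c (s03_scale d x) = s03_scale (c * d) x"
    by transfer (simp add: mult_map_scale_conv_mult mult.assoc[symmetric] mult_single s03_zeroI)
  show "s03_scale 1 x = x"
    by transfer (simp add: mult_map_scale_conv_mult s03_zeroI)
  show "s03_scale c x * y = s03_scale c (x * y)"
    by transfer (simp add: mult_map_scale_conv_mult mult.assoc s03_zeroI)
  show "x * s03_scale c y = s03_scale c (x * y)"
    by transfer (simp add: mult_map_scale_conv_mult mult.assoc[symmetric] single_Nil_commute s03_zeroI)
qed


lemma s03_relation_eq:
  assumes "(l, r) \<in> s03_relations"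
  shows "abs_s03 l = abs_s03 r"
proof -
  have "1 * (l - r) * 1 \<in> s03_ideal"
    unfolding s03_ideal_def by (rule two_sided_ideal.generator) (use assms in blast)
  then show ?thesis by (simp add: s03.abs_eq_iff)
qed

lemma s03_relations:
  "Dt^3 = Dt" "Bt^2 * Dt = Dt" "Dt * Bt^2 = Dt" "Bt * Ct - Ct * Bt = - 2 * Dt"
  "Dt * Bt = - Bt * Dt" "- Bt * Dt = Ct * Dt^2" "Ct * Dt^2 = Dt^2 * Ct"
  "Ct * Dt + Dt * Ct = 0" "Bt^2 + Ct^2 = 0" "Bt^3 = Bt" "Ct^3 = - Ct"
proof -
  have hom: "abs_s03 x * abs_s03 y = abs_s03 (x * y)" "abs_s03 x + abs_s03 y = abs_s03 (x + y)"
    "abs_s03 x - abs_s03 y = abs_s03 (x - y)" "- abs_s03 x = abs_s03 (- x)"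
    "1 = abs_s03 1" "0 = abs_s03 0" for x y
    by (simp_all add: times_s03.abs_eq plus_s03.abs_eq minus_s03.abs_eq uminus_s03.abs_eq
        one_s03.abs_eq zero_s03.abs_eq)
  have pow: "abs_s03 x ^ n = abs_s03 (x ^ n)" for x n
    by (induction n) (simp_all only: power_0 power_Suc hom)
  have two: "(2::s03) = abs_s03 2"
    by (simp only: hom one_add_one[symmetric])
  show "Dt^3 = Dt" "Bt^2 * Dt = Dt" "Dt * Bt^2 = Dt" "Bt * Ct - Ct * Bt = - 2 * Dt"
    "Dt * Bt = - Bt * Dt" "- Bt * Dt = Ct * Dt^2" "Ct * Dt^2 = Dt^2 * Ct"
    "Ct * Dt + Dt * Ct = 0" "Bt^2 + Ct^2 = 0" "Bt^3 = Bt" "Ct^3 = - Ct"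
    unfolding Bt_def Ct_def Dt_def two pow hom
    by (rule s03_relation_eq; simp add: s03_relations_def Let_def)+
qed

lemma s03_invariantI:
  assumes W: "s03.subspace W"
    and inv: "\<And>w. w \<in> W \<Longrightarrow> Bt * w \<in> W" "\<And>w. w \<in> W \<Longrightarrow> Ct * w \<in> W"
      "\<And>w. w \<in> W \<Longrightarrow> Dt * w \<in> W"
    and w: "w \<in> W"
  shows "a * w \<in> W"
proof -
  obtain p where a: "a = abs_s03 p" by (metis Quotient_abs_rep Quotient_s03)
  have "abs_s03 p * w \<in> W"
  proof (induction p rule: free_alg_induct)
    case (add p q)
    then show ?case
      using s03.subspace_add[OF W] by (simp add: plus_s03.abs_eq[symmetric] distrib_right)
  next
    case (single u c)
    show ?case
    proof (induction u)
      case Nil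
      have "abs_s03 (Poly_Mapping.single [] c) = s03_scale c 1"
        by (simp add: one_s03.abs_eq s03_scale.abs_eq mult_map_scale_conv_mult zero_list_def)
      then show ?case using s03.subspace_scale[OF W w] by (simp add: s03.scale_mult_left)
    next
      case (Cons g u)
      have "Poly_Mapping.single (g # u) c = gen g * Poly_Mapping.single u c"
        by (simp add: gen_def mult_single plus_list_def)
      then have "abs_s03 (Poly_Mapping.single (g # u) c) * w
          = abs_s03 (gen g) * (abs_s03 (Poly_Mapping.single u c) * w)"
        by (simp add: times_s03.abs_eq[symmetric] mult.assoc)
      then show ?case
        using inv Cons by (cases g) (simp_all add: Bt_def Ct_def Dt_def)
    qed
  qed
  then show ?thesis by (simp add: a)
qed

section \<open>The left regular representation and its quotient\<close>

interpretation LRR: algebra_rep s03_scale s03_scale "(*)"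
  by unfold_locales (simp_all add: distrib_left distrib_right s03.scale_mult_left
      s03.scale_mult_right mult.assoc)

definition v0 :: "nat \<Rightarrow> s03" where
  "v0 k = (if k = 1 then Dt + Dt^2 else Bt * Dt - Dt * Ct)"

definition v1 :: "nat \<Rightarrow> s03" where
  "v1 k = (if k = 1 then Bt * Dt + Dt * Ct else Dt - Dt^2)"

definition irr2 :: "nat \<Rightarrow> s03 set" where
  "irr2 k = s03.span {v0 k, v1 k}"

definition triv :: "s03 set" where
  "triv = s03.span {Bt^2 - 1}"

definition sub5 :: "s03 set" where
  "sub5 = {x + y + z | x y z. x \<in> irr2 1 \<and> y \<in> irr2 2 \<and> z \<in> triv}"

lemma lrr_actions:
  "Bt * v0 k = v1 k" "Bt * v1 k = v0 k"
  "Ct * v0 k = - v1 k" "Ct * v1 k = v0 k"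
  "Dt * v0 k = v0 k" "Dt * v1 k = - v1 k"
  "Bt * (Bt^2 - 1) = 0" "Ct * (Bt^2 - 1) = 0" "Dt * (Bt^2 - 1) = 0"
proof -
  note rel = s03_relations[unfolded power2_eq_square power3_eq_cube]
  have DB: "Dt * Bt = - (Bt * Dt)" using rel(5) by simp
  have DC: "Ct * Dt = - (Dt * Ct)" using rel(8) by (simp add: eq_neg_iff_add_eq_0)
  have CDD: "Ct * (Dt * Dt) = - (Bt * Dt)" using rel(6) by simp
  have DDC: "Dt * (Dt * Ct) = - (Bt * Dt)" using rel(6,7) by (simp add: mult.assoc)
  have DDD: "Dt * (Dt * Dt) = Dt" using rel(1) by (simp add: mult.assoc)
  have BBD: "Bt * (Bt * Dt) = Dt" using rel(2) by (simp add: mult.assoc)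
  have CC: "Ct * Ct = - (Bt * Bt)" using rel(9) by (simp add: eq_neg_iff_add_eq_0 add.commute)
  have BDD: "Bt * (Dt * Dt) = Dt * Ct"
  proof -
    have "Bt * (Dt * Dt) = - (Ct * (Dt * Dt)) * Dt" by (simp add: CDD mult.assoc)
    also have "\<dots> = - (Ct * (Dt * (Dt * Dt)))" by (simp add: mult.assoc)
    finally show ?thesis by (simp add: DDD DC)
  qed
  have DBD: "Dt * (Bt * Dt) = - (Dt * Ct)"
    using BDD by (simp add: mult.assoc[symmetric] DB)
  have BBDD: "Bt * (Dt * Ct) = Dt * Dt"
    using BBD by (simp add: BDD[symmetric] mult.assoc[symmetric])
  have CDC: "Ct * (Dt * Ct) = Dt"
  proof -
    have "Ct * (Dt * Ct) = - (Dt * (Ct * Ct))"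
      using DC by (simp add: mult.assoc[symmetric])
    then show ?thesis using rel(3) by (simp add: CC)
  qed
  have CBD: "Ct * (Bt * Dt) = Dt * Dt"
  proof -
    have "Ct * (Bt * Dt) = - (Ct * (Ct * (Dt * Dt)))" by (simp add: CDD)
    also have "\<dots> = Bt * (Bt * (Dt * Dt))" by (simp add: mult.assoc[symmetric] CC)
    finally show ?thesis using BBD by (simp add: mult.assoc[symmetric])
  qed
  show "Bt * v0 k = v1 k" "Bt * v1 k = v0 k" "Ct * v0 k = - v1 k" "Ct * v1 k = v0 k"
    "Dt * v0 k = v0 k" "Dt * v1 k = - v1 k"
    by (simp_all add: v0_def v1_def power2_eq_square distrib_left right_diff_distrib
        DC CDD DDC DDD BBD BDD DBD BBDD CDC CBD)
  show "Bt * (Bt^2 - 1) = 0" "Dt * (Bt^2 - 1) = 0"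
    using rel(3,10) by (simp_all add: power2_eq_square right_diff_distrib mult.assoc)
  have "Ct * (Bt * Bt) = - (Ct * (Ct * Ct))" by (simp add: CC)
  then show "Ct * (Bt^2 - 1) = 0"
    using rel(11) by (simp add: power2_eq_square right_diff_distrib mult.assoc)
qed

lemma s03_generator_invariant:
  assumes gens: "\<And>x. x \<in> S \<Longrightarrow> Bt * x \<in> s03.span S \<and> Ct * x \<in> s03.span S \<and> Dt * x \<in> s03.span S"
  shows "LRR.subrep (s03.span S)"
proof -
  have "g * w \<in> s03.span S" if "w \<in> s03.span S" "\<And>x. x \<in> S \<Longrightarrow> g * x \<in> s03.span S" for g w
    using that(1)
  proof (induction rule: s03.span_induct_alt)
    case base
    show ?case by (simp add: s03.span_zero)
  next
    case (step c x y)
    then show ?case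
      using that(2) by (simp add: distrib_left s03.scale_mult_right s03.span_add s03.span_scale)
  qed
  then show ?thesis
    unfolding LRR.subrep_def using s03_invariantI[OF s03.subspace_span] gens by blast
qed

lemma subrep_irr2: "LRR.subrep (irr2 k)"
  unfolding irr2_def
  by (rule s03_generator_invariant)
    (auto simp: lrr_actions s03.span_base s03.span_neg)

lemma subrep_triv: "LRR.subrep triv"
  unfolding triv_def
  by (rule s03_generator_invariant) (auto simp: lrr_actions s03.span_zero)

lemma subrep_sub5: "LRR.subrep sub5"
proof -
  have "\<exists>x y z. 0 = x + y + z \<and> x \<in> irr2 1 \<and> y \<in> irr2 2 \<and> z \<in> triv"
    using subrep_irr2 subrep_triv unfolding LRR.subrep_def
    by (intro exI[of _ 0]) (auto intro: s03.subspace_0)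
  moreover have "u + v \<in> sub5" if u: "u \<in> sub5" and v: "v \<in> sub5" for u v
  proof -
    from u obtain x y z where 1: "u = x + y + z" "x \<in> irr2 1" "y \<in> irr2 2" "z \<in> triv"
      unfolding sub5_def by blast
    from v obtain x' y' z' where 2: "v = x' + y' + z'" "x' \<in> irr2 1" "y' \<in> irr2 2" "z' \<in> triv"
      unfolding sub5_def by blast
    have "u + v = (x + x') + (y + y') + (z + z')"
      by (simp add: 1 2 algebra_simps)
    then show ?thesis
      using 1 2 subrep_irr2 subrep_triv unfolding sub5_def LRR.subrep_def
      by (blast intro: s03.subspace_add)
  qed
  moreover have "s03_scale c u \<in> sub5" if u: "u \<in> sub5" for c u
  proof -
    from u obtain x y z where 1: "u = x + y + z" "x \<in> irr2 1" "y \<in> irr2 2" "z \<in> triv"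
      unfolding sub5_def by blast
    have "s03_scale c u = s03_scale c x + s03_scale c y + s03_scale c z"
      by (simp add: 1 s03.scale_right_distrib)
    then show ?thesis
      using 1 subrep_irr2 subrep_triv unfolding sub5_def LRR.subrep_def
      by (blast intro: s03.subspace_scale)
  qed
  moreover have "a * u \<in> sub5" if u: "u \<in> sub5" for a u
  proof -
    from u obtain x y z where 1: "u = x + y + z" "x \<in> irr2 1" "y \<in> irr2 2" "z \<in> triv"
      unfolding sub5_def by blast
    have "a * u = a * x + a * y + a * z"
      by (simp add: 1 distrib_left)
    then show ?thesis
      using 1 subrep_irr2 subrep_triv unfolding sub5_def LRR.subrep_def by blast
  qed
  ultimately show ?thesis
    unfolding LRR.subrep_def s03.subspace_def by (auto simp: sub5_def)
qed

lemmas sub5_subspace = subrep_sub5[unfolded LRR.subrep_def, THEN conjunct1]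

lemma sub5_closed:
  "0 \<in> sub5" "x \<in> sub5 \<Longrightarrow> y \<in> sub5 \<Longrightarrow> x + y \<in> sub5" "x \<in> sub5 \<Longrightarrow> - x \<in> sub5"
  "x \<in> sub5 \<Longrightarrow> y \<in> sub5 \<Longrightarrow> x - y \<in> sub5" "x \<in> sub5 \<Longrightarrow> a * x \<in> sub5"
  "x \<in> sub5 \<Longrightarrow> s03_scale c x \<in> sub5"
  using sub5_subspace subrep_sub5
  by (auto simp: LRR.subrep_def
      intro: s03.subspace_0 s03.subspace_add s03.subspace_neg s03.subspace_diff s03.subspace_scale)

quotient_type lrr_quot = s03 / "\<lambda>x y. x - y \<in> sub5"
proof (rule equivpI)
  show "reflp (\<lambda>x y. x - y \<in> sub5)"
    by (simp add: reflp_def sub5_closed)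
  show "symp (\<lambda>x y. x - y \<in> sub5)"
    unfolding symp_def using sub5_closed(3) by fastforce
  show "transp (\<lambda>x y. x - y \<in> sub5)"
    unfolding transp_def
  proof (intro allI impI)
    fix x y z :: s03
    assume "x - y \<in> sub5" "y - z \<in> sub5"
    then have "(x - y) + (y - z) \<in> sub5" by (rule sub5_closed(2))
    then show "x - z \<in> sub5" by simp
  qed
qed

instantiation lrr_quot :: ab_group_add
begin

lift_definition zero_lrr_quot :: lrr_quot is 0 .
lift_definition plus_lrr_quot :: "lrr_quot \<Rightarrow> lrr_quot \<Rightarrow> lrr_quot" is "(+)"
  by (simp only: add_diff_add sub5_closed(2))
lift_definition uminus_lrr_quot :: "lrr_quot \<Rightarrow> lrr_quot" is uminus
  by (simp only: minus_diff_minus sub5_closed(3))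
lift_definition minus_lrr_quot :: "lrr_quot \<Rightarrow> lrr_quot \<Rightarrow> lrr_quot" is "(-)"
proof -
  fix a b c d :: s03
  assume "a - b \<in> sub5" "c - d \<in> sub5"
  then have "(a - b) - (c - d) \<in> sub5" by (rule sub5_closed(4))
  then show "(a - c) - (b - d) \<in> sub5" by (simp add: algebra_simps)
qed

instance
  by standard (transfer; simp add: sub5_closed algebra_simps)+

end

lifting_forget s03.lifting

lift_definition cls :: "s03 \<Rightarrow> lrr_quot" is "\<lambda>x. x" .

lift_definition quot_scale :: "complex \<Rightarrow> lrr_quot \<Rightarrow> lrr_quot" is s03_scale
  by (simp only: s03.scale_right_diff_distrib[symmetric] sub5_closed(6))

lift_definition quot_act :: "s03 \<Rightarrow> lrr_quot \<Rightarrow> lrr_quot" is "(*)"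
  by (simp only: right_diff_distrib[symmetric] sub5_closed(5))

interpretation Quot: algebra_rep s03_scale quot_scale quot_act
  by unfold_locales
    (transfer; simp add: sub5_closed algebra_simps s03.scale_mult_left s03.scale_mult_right)+

definition v_rep :: "complex \<Rightarrow> complex \<Rightarrow> s03" where
  "v_rep e e' = Bt + s03_scale e 1 - s03_scale (\<i> * e * e') Ct - s03_scale (\<i> * e') (Bt * Ct)"

end

(* Nondegeneracy needs actual representations: a two-dimensional matrix representation shows
   D \<noteq> 0, and the characters B \<mapsto> b, C \<mapsto> c, D \<mapsto> 0 with (b, c) = (0, 0) or (\<epsilon>, \<i>\<epsilon>') detect
   B^2 - 1 and the classes of the vectors v_{\<epsilon>,\<epsilon>'}. The direct sums come from explicit projections:
   right multiplication by (1 + D)/2 and (1 - D)/2 in (1), the action of (1 + \<epsilon>B)(1 - \<i>\<epsilon>'C)/4 in (3).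
   The isomorphism in (1) is right multiplication by -B, and the four v_{\<epsilon>,\<epsilon>'} span the quotient
   because their span is a subrepresentation containing the class of 1. *)

theory Submission
  imports Defs "HOL-Library.Product_Plus"
begin

section \<open>Representations\<close>

context algebra_rep
begin

lemma act_zero [simp]: "act a 0 = 0"
  using act_add_right[of a 0 0] by simp

lemma act_zero_left [simp]: "act 0 v = 0"
  using act_add_left[of 0 0 v] by simp

lemma act_minus_left: "act (- a) v = - act a v"
  using act_add_left[of a "- a" v] by (simp add: eq_neg_iff_add_eq_0 add.commute)

lemma act_diff_left: "act (a - b) v = act a v - act b v"
  using act_add_left[of a "- b" v] by (simp add: act_minus_left)

text \<open>Both sides are linear in \<open>u\<close>. The cases \<open>c = 0\<close> and
  \<open>c = 1\<close> later give vanishing and identity actions on whole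
  subrepresentations.\<close>

lemma act_eq_scale_on_span:
  assumes "u \<in> span S" "\<And>x. x \<in> S \<Longrightarrow> act a x = scale c x"
  shows "act a u = scale c u"
  using assms(1)
proof (induction rule: span_induct_alt)
  case (step d x y)
  then show ?case
    using assms(2) by (simp add: act_add_right act_scale_right scale_right_distrib mult.commute)
qed simp

text \<open>By linearity each \<open>P i\<close> is the identity on its own summand and zero on the
  others. Applying \<open>P i\<close> to a sum returns the \<open>i\<close>-th component, which
  gives uniqueness, and the vectors \<open>P i u\<close> themselves give existence.\<close>

lemma direct_sum_span_projections:
  assumes I: "finite I" "\<And>i. i \<in> I \<Longrightarrow> subrep (span (S i))"
    and P_add: "\<And>i x y. P i (x + y) = P i x + P i y"
    and P_scale: "\<And>i c x. P i (scale c x) = scale c (P i x)"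
    and P_same: "\<And>i x. i \<in> I \<Longrightarrow> x \<in> S i \<Longrightarrow> P i x = x"
    and P_other: "\<And>i j x. i \<in> I \<Longrightarrow> j \<in> I \<Longrightarrow> i \<noteq> j \<Longrightarrow> x \<in> S j \<Longrightarrow> P i x = 0"
  shows "direct_sum I (\<lambda>i. span (S i)) (span (\<Union>i\<in>I. S i))"
proof -
  have P0: "P i 0 = 0" for i using P_add[of i 0 0] by simp
  have P_sum: "P i (\<Sum>j\<in>J. f j) = (\<Sum>j\<in>J. P i (f j))" for i J f
    by (induction J rule: infinite_finite_induct) (simp_all add: P0 P_add)
  have same: "P i x = x" if "i \<in> I" "x \<in> span (S i)" for i x
    using that(2) by (induction rule: span_induct_alt) (simp_all add: P0 P_add P_scale P_same that)
  have other: "P i x = 0" if "i \<in> I" "j \<in> I" "i \<noteq> j" "x \<in> span (S j)" for i j x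
    using that(4)
    by (induction rule: span_induct_alt) (simp_all add: P0 P_add P_scale P_other[OF that(1-3)])
  have component: "P i (\<Sum>j\<in>I. f j) = f i" if i: "i \<in> I" and f: "f \<in> PiE I (\<lambda>i. span (S i))" for i f
  proof -
    have "P i (\<Sum>j\<in>I. f j) = (\<Sum>j\<in>I. if j = i then f i else 0)"
      unfolding P_sum using f i by (intro sum.cong) (auto simp: same other PiE_iff)
    then show ?thesis using I i by simp
  qed
  have decompose: "(\<forall>i\<in>I. P i u \<in> span (S i)) \<and> (\<Sum>i\<in>I. P i u) = u"
    if "u \<in> span (\<Union>i\<in>I. S i)" for u
    using that
  proof (induction rule: span_induct_alt)
    case base
    show ?case by (simp add: P0 span_zero)
  next
    case (step c x y)
    then obtain j where j: "j \<in> I" "x \<in> S j" by blast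
    \<comment> \<open>A generator from \<open>S j\<close> has only its \<open>j\<close>-th
      projection left, so the projections add up to the identity on generators.\<close>
    have Px: "P i x = (if i = j then x else 0)" if "i \<in> I" for i
      using that j P_same P_other by auto
    have "(\<Sum>i\<in>I. P i x) = (\<Sum>i\<in>I. if i = j then x else 0)"
      by (rule sum.cong) (simp_all add: Px)
    then have "(\<Sum>i\<in>I. P i x) = x"
      using I j by simp
    moreover have "P i x \<in> span (S i)" if "i \<in> I" for i
      using that j Px by (auto simp: span_zero span_base)
    ultimately show ?case
      using step by (simp add: P_add P_scale span_add span_scale sum.distrib scale_sum_right[symmetric])
  qed
  have "inj_on (\<lambda>f. \<Sum>i\<in>I. f i) (PiE I (\<lambda>i. span (S i)))"
    by (rule inj_onI, rule PiE_ext, assumption+) (metis component)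
  moreover have "(\<lambda>f. \<Sum>i\<in>I. f i) ` PiE I (\<lambda>i. span (S i)) = span (\<Union>i\<in>I. S i)"
  proof
    show "(\<lambda>f. \<Sum>i\<in>I. f i) ` PiE I (\<lambda>i. span (S i)) \<subseteq> span (\<Union>i\<in>I. S i)"
      by (auto simp: PiE_iff intro!: span_sum) (meson UN_upper span_mono subsetD)
  next
    show "span (\<Union>i\<in>I. S i) \<subseteq> (\<lambda>f. \<Sum>i\<in>I. f i) ` PiE I (\<lambda>i. span (S i))"
    proof
      fix u assume "u \<in> span (\<Union>i\<in>I. S i)"
      \<comment> \<open>Members of \<open>PiE\<close> are \<open>undefined\<close> outside
        \<open>I\<close>, hence the restriction.\<close>
      then have "restrict (\<lambda>i. P i u) I \<in> PiE I (\<lambda>i. span (S i))"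
        "u = (\<Sum>i\<in>I. restrict (\<lambda>i. P i u) I i)"
        using decompose by auto
      then show "u \<in> (\<lambda>f. \<Sum>i\<in>I. f i) ` PiE I (\<lambda>i. span (S i))" by blast
    qed
  qed
  ultimately show ?thesis
    using I unfolding direct_sum_def bij_betw_def by blast
qed

text \<open>An isomorphism carries an eigenvector of \<open>act a\<close> to a nonzero eigenvector
  with the same eigenvalue, but on \<open>U'\<close> only the eigenvalue \<open>d\<close>
  occurs.\<close>

lemma not_isomorphic_if_eigenvalue_neq:
  assumes "v \<noteq> 0" "v \<in> U" and v: "act a v = scale c v"
    and U': "\<And>u. u \<in> U' \<Longrightarrow> act a u = scale d u" and "c \<noteq> d"
  shows "\<not> isomorphic U U'"
proof
  assume "isomorphic U U'"
  then obtain f where f: "subrep_iso f U U'" unfolding isomorphic_def ..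
  then have bij: "bij_betw f U U'" and U: "0 \<in> U"
    by (auto simp: subrep_iso_def subrep_def subspace_0)
  have hom: "f (scale r u) = scale r (f u)" "f (act a u) = act a (f u)" if "u \<in> U" for u r
    using f that by (auto simp: subrep_iso_def)
  have "f 0 = 0" using hom(1)[OF U, of 0] by simp
  then have "f v \<noteq> 0"
    using bij U assms(1,2) by (metis bij_betw_imp_inj_on inj_onD)
  moreover have "scale c (f v) = scale d (f v)"
    using hom[OF assms(2)] v U' bij assms(2) by (metis bij_betwE)
  ultimately show False using \<open>c \<noteq> d\<close> by simp
qed

end

lemma (in vector_space) dim_span_singleton:
  assumes "v \<noteq> 0"
  shows "dim (span {v}) = 1"
  using assms dim_span_eq_card_independent[of "{v}"] by (simp add: dependent_single)

text \<open>The algebra elements that preserve the span form a linear subspace containing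
  \<open>1\<close> and closed under left multiplication by the generators. Invariance in the left
  regular representation then puts every \<open>a * 1\<close> into it.\<close>

lemma subrep_span_if_generators:
  assumes "algebra_rep s03_scale scale act"
    and S: "\<And>g x. g \<in> {Bt, Ct, Dt} \<Longrightarrow> x \<in> S \<Longrightarrow> act g x \<in> module.span scale S"
  shows "algebra_rep.subrep scale act (module.span scale S)"
proof -
  interpret algebra_rep s03_scale scale act by fact
  have gen: "act g w \<in> span S" if "w \<in> span S" "g \<in> {Bt, Ct, Dt}" for g w
    using that(1)
  proof (induction rule: span_induct_alt)
    case base
    show ?case by (simp add: span_zero)
  next
    case (step c x y)
    then show ?case
      using S that(2) by (simp add: act_add_right act_scale_right span_add span_scale)
  qed
  let ?W = "{a. \<forall>w\<in>span S. act a w \<in> span S}"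
  have "s03.subspace ?W"
    by (auto simp: s03.subspace_def act_add_left act_scale_left span_zero span_add span_scale)
  then have "a * 1 \<in> ?W" for a
    by (rule s03_invariantI) (simp_all add: gen act_mult act_one)
  then show ?thesis
    unfolding subrep_def by (simp add: subspace_span)
qed

section \<open>The universal property of s03'\<close>

locale free_alg_rep = vector_space scale
  for scale :: "complex \<Rightarrow> 'v::ab_group_add \<Rightarrow> 'v" +
  fixes T :: "'g \<Rightarrow> 'v \<Rightarrow> 'v"
  assumes T_add: "T g (u + v) = T g u + T g v"
    and T_scale: "T g (scale c v) = scale c (T g v)"
begin

text \<open>With \<open>foldr\<close> the first letter of a word acts last, so concatenation becomes
  composition and \<open>eval\<close> is a left action.\<close>

definition eval :: "'g free_alg \<Rightarrow> 'v \<Rightarrow> 'v" where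
  "eval p v = (\<Sum>w\<in>Poly_Mapping.keys p. scale (poly_mapping.lookup p w) (foldr T w v))"

text \<open>Enlarging the index set adds only zero coefficients; this lets sums over different
  supports be compared over a common set.\<close>

lemma eval_superset:
  assumes "finite A" "Poly_Mapping.keys p \<subseteq> A"
  shows "eval p v = (\<Sum>w\<in>A. scale (poly_mapping.lookup p w) (foldr T w v))"
  unfolding eval_def using assms by (intro sum.mono_neutral_left) (auto simp: in_keys_iff)

lemma eval_single: "eval (Poly_Mapping.single w c) v = scale c (foldr T w v)"
  by (subst eval_superset[of "{w}"]) (auto simp: keys_single)

lemma eval_add: "eval (p + q) v = eval p v + eval q v"
  using keys_add[of p q]
  by (simp add: eval_superset[of "Poly_Mapping.keys p \<union> Poly_Mapping.keys q"]
      lookup_add scale_left_distrib sum.distrib)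

lemma foldr_T_add: "foldr T w (u + v) = foldr T w u + foldr T w v"
  by (induction w) (simp_all add: T_add)

lemma foldr_T_scale: "foldr T w (scale c v) = scale c (foldr T w v)"
  by (induction w) (simp_all add: T_scale)

lemma eval_add_right: "eval p (u + v) = eval p u + eval p v"
  by (simp add: eval_def foldr_T_add scale_right_distrib sum.distrib)

lemma eval_scale_right: "eval p (scale c v) = scale c (eval p v)"
  by (simp add: eval_def foldr_T_scale scale_sum_right mult.commute)

text \<open>Additivity in both factors reduces the claim to two monomials, whose words are
  concatenated.\<close>

lemma eval_mult: "eval (p * q) v = eval p (eval q v)"
proof (induction p rule: free_alg_induct)
  case (single w c)
  show ?case
  proof (induction q rule: free_alg_induct)
    case (single u d)
    show ?case by (simp add: mult_single eval_single plus_list_def foldr_T_scale)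
  next
    case (add p q)
    then show ?case by (simp add: distrib_left eval_add eval_add_right)
  qed
next
  case (add p q)
  then show ?case by (simp add: distrib_right eval_add)
qed

lemma eval_one: "eval 1 v = v"
  using eval_single[of "[]" 1 v] by (simp add: zero_list_def flip: single_one)

lemma eval_zero: "eval 0 v = 0"
  by (simp add: eval_def)

lemma eval_minus: "eval (- p) v = - eval p v"
  using eval_add[of p "- p" v] by (simp add: eval_zero eq_neg_iff_add_eq_0 add.commute)

lemma eval_diff: "eval (p - q) v = eval p v - eval q v"
  using eval_add[of p "- q" v] by (simp add: eval_minus)

lemma eval_gen: "eval (gen g) v = T g v"
  by (simp add: gen_def eval_single)

lemmas eval_simps = eval_add eval_mult eval_one eval_zero eval_minus eval_diff eval_gen

end

locale s03_rep = free_alg_rep scale T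
  for scale :: "complex \<Rightarrow> 'v::ab_group_add \<Rightarrow> 'v" and T :: "s03_gen \<Rightarrow> 'v \<Rightarrow> 'v" +
  assumes relations: "(l, r) \<in> s03_relations \<Longrightarrow> eval l v = eval r v"
begin

text \<open>\<open>rep_s03\<close> picks some representative of the class; \<open>act_abs\<close>
  shows that any other gives the same operator.\<close>

definition act :: "s03 \<Rightarrow> 'v \<Rightarrow> 'v" where
  "act a = eval (rep_s03 a)"

text \<open>In \<open>a * s * b\<close> the relator \<open>s\<close> acts as zero on every vector,
  in particular on the image of \<open>b\<close>.\<close>

lemma eval_ideal: "p \<in> s03_ideal \<Longrightarrow> eval p v = 0"
  unfolding s03_ideal_def
proof (induction arbitrary: v rule: two_sided_ideal.induct)
  case (generator s a b)
  then obtain l r where lr: "s = l - r" "(l, r) \<in> s03_relations" by blast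
  have "eval p 0 = 0" for p using eval_scale_right[of p 0 0] by simp
  then show ?case by (simp add: lr(1) eval_mult eval_diff relations[OF lr(2)])
qed (simp_all add: eval_simps)

lemma act_abs: "act (abs_s03 p) v = eval p v"
proof -
  have "abs_s03 (rep_s03 (abs_s03 p)) = abs_s03 p"
    by (rule Quotient_abs_rep[OF Quotient_s03])
  then have "rep_s03 (abs_s03 p) - p \<in> s03_ideal"
    by (simp only: s03.abs_eq_iff)
  then have "eval (rep_s03 (abs_s03 p) - p) v = 0" by (rule eval_ideal)
  then show ?thesis by (simp add: act_def eval_diff)
qed

sublocale algebra_rep s03_scale scale act
proof
  fix a b :: s03 and c :: complex and u v :: 'v
  obtain p q where pq: "a = abs_s03 p" "b = abs_s03 q"
    by (rule that[of "rep_s03 a" "rep_s03 b"]) (simp_all only: Quotient_abs_rep[OF Quotient_s03])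
  show "act a (u + v) = act a u + act a v" "act a (scale c v) = scale c (act a v)"
    by (simp_all add: act_def eval_add_right eval_scale_right)
  show "act (a + b) v = act a v + act b v" "act (a * b) v = act a (act b v)"
    by (simp_all add: pq plus_s03.abs_eq times_s03.abs_eq act_abs eval_simps)
  show "act 1 v = v"
    by (simp add: one_s03.abs_eq act_abs eval_one)
  have "eval (Poly_Mapping.single 0 c) w = scale c w" for w
    by (simp add: zero_list_def eval_single)
  then show "act (s03_scale c a) v = scale c (act a v)"
    by (simp add: pq s03_scale.abs_eq act_abs mult_map_scale_conv_mult eval_mult)
qed

lemma act_generators: "act Bt v = T GB v" "act Ct v = T GC v" "act Dt v = T GD v"
  by (simp_all add: Bt_def Ct_def Dt_def act_abs eval_gen)

end

text \<open>A presentation by relations could collapse, so a model is required. The operators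
  \<open>T\<close> are the action prescribed for \<open>v0 k\<close>, \<open>v1 k\<close>, in
  coordinates where these are \<open>(1, 0)\<close> and \<open>(0, 1)\<close>; there
  \<open>Dt\<close> fixes \<open>(1, 0)\<close>.\<close>

lemma Dt_nonzero: "Dt \<noteq> 0"
proof
  assume "Dt = 0"
  define T :: "s03_gen \<Rightarrow> complex \<times> complex \<Rightarrow> complex \<times> complex" where
    "T = rec_s03_gen (\<lambda>v. (snd v, fst v)) (\<lambda>v. (snd v, - fst v)) (\<lambda>v. (fst v, - snd v))"
  have T: "T GB v = (snd v, fst v)" "T GC v = (snd v, - fst v)" "T GD v = (fst v, - snd v)" for v
    by (simp_all add: T_def)
  define scl :: "complex \<Rightarrow> complex \<times> complex \<Rightarrow> complex \<times> complex" where
    "scl c v = (c * fst v, c * snd v)" for c v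
  interpret free_alg_rep scl T
  proof
    show "T g (u + v) = T g u + T g v" "T g (scl c v) = scl c (T g v)" for g c u v
      by (cases g; simp add: T scl_def prod_eq_iff)+
  qed (simp_all add: scl_def prod_eq_iff algebra_simps)
  interpret s03_rep scl T
  proof
    fix l r v assume "(l, r) \<in> s03_relations"
    then show "eval l v = eval r v"
      unfolding s03_relations_def Let_def power2_eq_square power3_eq_cube mult_minus_left mult_2
      by (elim insertE Pair_inject emptyE; simp add: eval_simps T prod_eq_iff)
  qed
  have "act Dt (1, 0) = (1, 0)" by (simp add: act_generators T)
  with \<open>Dt = 0\<close> show False by (simp add: prod_eq_iff)
qed

text \<open>Once \<open>Dt\<close> goes to \<open>0\<close> and the values commute, the defining
  relations reduce to the three conditions on \<open>b\<close> and \<open>c\<close>.\<close>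

lemma s03_character:
  fixes b c :: complex
  assumes "b^2 + c^2 = 0" "b^3 = b" "c^3 = - c"
  shows "\<exists>\<chi>. (\<forall>x y. \<chi> (x + y) = \<chi> x + \<chi> y) \<and> (\<forall>x y. \<chi> (x - y) = \<chi> x - \<chi> y) \<and>
    (\<forall>x y. \<chi> (x * y) = \<chi> x * \<chi> y) \<and> (\<forall>r x. \<chi> (s03_scale r x) = r * \<chi> x) \<and> \<chi> 1 = 1 \<and>
    \<chi> Bt = b \<and> \<chi> Ct = c \<and> \<chi> Dt = 0"
proof -
  define T :: "s03_gen \<Rightarrow> complex \<Rightarrow> complex" where
    "T g = (*) (case g of GB \<Rightarrow> b | GC \<Rightarrow> c | GD \<Rightarrow> 0)" for g
  interpret free_alg_rep "(*)" T
    by unfold_locales (auto simp: T_def algebra_simps)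
  have rel: "b * b = - (c * c)" "c * c * c = - c" "b * b * b = b"
    using assms(1) by (simp add: power2_eq_square eq_neg_iff_add_eq_0)
      (use assms(2,3) in \<open>simp_all only: power3_eq_cube\<close>)
  \<comment> \<open>Rewriting \<open>b * b\<close> to \<open>- (c * c)\<close> turns
    \<open>Bt^3 = Bt\<close> into a statement about this product.\<close>
  have "b * c * c = - b"
    using rel(1,3) by (metis minus_minus mult.assoc mult_minus_right)
  interpret s03_rep "(*)" T
  proof
    fix l r v assume "(l, r) \<in> s03_relations"
    moreover have "b * (b * v) = - (c * (c * v))" "b * (c * v) = c * (b * v)"
      "c * (c * (c * v)) = - (c * v)" "b * (c * (c * v)) = - (b * v)"
      using rel(1,2) \<open>b * c * c = - b\<close> by (simp_all flip: mult.assoc)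
    ultimately show "eval l v = eval r v"
      unfolding s03_relations_def Let_def power2_eq_square power3_eq_cube mult_minus_left mult_2
      by (elim insertE Pair_inject emptyE; simp add: eval_simps T_def)
  qed
  \<comment> \<open>The representation space is one-dimensional, so \<open>a\<close> acts as the
    scalar \<open>act a 1\<close>; composition of scalars is their product.\<close>
  have act_right: "act a v = v * act a 1" for a v
    using act_scale_right[of a v 1] by simp
  show ?thesis
  proof (intro exI[of _ "\<lambda>a. act a 1"] conjI allI)
    show "act (x * y) 1 = act x 1 * act y 1" for x y
      using act_right[of x "act y 1"] by (simp add: act_mult)
  qed (simp_all add: act_add_left act_diff_left act_scale_left act_one act_generators T_def)
qed

section \<open>The two-dimensional subrepresentations\<close>

lemma v1_eq: "v1 k = Bt * v0 k"
  by (simp add: lrr_actions)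

lemma v0_eq: "v0 k = Bt * v1 k"
  by (simp add: lrr_actions)

text \<open>\<open>v0 1\<close> and \<open>v1 2\<close> are polynomials in \<open>Dt\<close>, so
  \<open>Dt^3 = Dt\<close> decides them. The other two arise from these by left multiplication with
  \<open>Bt\<close>, which commutes with right multiplication.\<close>

lemma v_right_Dt:
  "v0 1 * Dt = v0 1" "v1 1 * Dt = v1 1" "v0 2 * Dt = - v0 2" "v1 2 * Dt = - v1 2"
proof -
  have DDD: "Dt * Dt * Dt = Dt"
    using s03_relations(1) by (simp add: power3_eq_cube)
  show 1: "v0 1 * Dt = v0 1" and 2: "v1 2 * Dt = - v1 2"
    by (simp_all add: v0_def v1_def power2_eq_square algebra_simps DDD[unfolded mult.assoc])
  show "v1 1 * Dt = v1 1" by (simp only: v1_eq mult.assoc 1)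
  show "v0 2 * Dt = - v0 2" by (simp only: v0_eq mult.assoc 2 mult_minus_right)
qed

text \<open>Only \<open>v0 1 * Bt\<close> has to be computed. Left multiplication by
  \<open>Bt\<close> yields the \<open>v1\<close> cases, and \<open>Dt * Bt^2 = Dt\<close> lets right
  multiplication by \<open>Bt\<close> be undone.\<close>

lemma v_right_Bt:
  "v0 1 * Bt = - v0 2" "v1 1 * Bt = - v1 2" "v0 2 * Bt = - v0 1" "v1 2 * Bt = - v1 1"
proof -
  note rel = s03_relations[unfolded power2_eq_square power3_eq_cube]
  have DB: "Dt * Bt = - (Bt * Dt)" using rel(5) by simp
  \<comment> \<open>Replacing \<open>Bt * Dt\<close> by \<open>- Ct * Dt^2\<close> creates a factor
    \<open>Dt^3\<close>, which collapses to \<open>Dt\<close>.\<close>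
  have "Bt * Dt * Dt = - (Ct * (Dt * Dt)) * Dt" using rel(6) by (metis minus_minus mult_minus_left)
  also have "\<dots> = - (Ct * (Dt * Dt * Dt))" by (simp only: mult.assoc mult_minus_left)
  also have "\<dots> = Dt * Ct" using rel(1,8) by (simp add: neg_eq_iff_add_eq_0)
  finally have BDD: "Bt * (Dt * Dt) = Dt * Ct" by (simp only: mult.assoc)
  have DDB: "Dt * Dt * Bt = Dt * Ct"
  proof -
    have "Dt * Dt * Bt = Dt * - (Bt * Dt)" by (simp only: mult.assoc DB)
    also have "\<dots> = - (Dt * Bt * Dt)" by (simp only: mult.assoc mult_minus_right)
    also have "\<dots> = Bt * (Dt * Dt)" by (simp only: DB mult_minus_left minus_minus) (simp only: mult.assoc)
    finally show ?thesis by (simp only: BDD)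
  qed
  show 1: "v0 1 * Bt = - v0 2"
    by (simp add: v0_def power2_eq_square distrib_right DB DDB)
  show "v1 1 * Bt = - v1 2" by (simp only: v1_eq mult.assoc 1 mult_minus_right)
  have "v0 1 * (Bt * Bt) = v0 1"
    using rel(3) by (simp add: v0_def power2_eq_square distrib_right mult.assoc)
  then show 2: "v0 2 * Bt = - v0 1"
    using 1 by (metis minus_equation_iff mult.assoc mult_minus_left)
  show "v1 2 * Bt = - v1 1" by (simp only: v1_eq mult.assoc 2 mult_minus_right)
qed

text \<open>Multiplications by \<open>Bt\<close> from either side permute the four vectors up to
  sign, so if \<open>v0 1\<close> vanished then so would \<open>v1 2\<close>, and with them
  \<open>v0 1 + v1 2\<close>, which is twice \<open>Dt\<close>.\<close>

lemma v_nonzero: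
  assumes "k \<in> {1, 2}"
  shows "v0 k \<noteq> 0" "v1 k \<noteq> 0"
proof -
  have "Dt = 0" if "v0 1 = 0"
  proof -
    have "v1 2 = 0" using that v_right_Bt(1) v1_eq[of 2] by simp
    moreover have "s03_scale 2 Dt = v0 1 + v1 2"
      using s03.scale_left_distrib[of 1 1 Dt] by (simp add: v0_def v1_def)
    ultimately show ?thesis using that by simp
  qed
  then have "v0 1 \<noteq> 0" using Dt_nonzero by blast
  moreover have "v0 2 \<noteq> 0"
    using calculation v_right_Bt(3) by auto
  ultimately show "v0 k \<noteq> 0" using assms by auto
  then show "v1 k \<noteq> 0" using v0_eq[of k] by auto
qed

text \<open>The two vectors are nonzero eigenvectors of \<open>Dt\<close> for the distinct
  eigenvalues \<open>1\<close> and \<open>-1\<close>.\<close>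

lemma independent_v:
  assumes k: "k \<in> {1, 2}"
  shows "s03.independent {v0 k, v1 k}" "v0 k \<noteq> v1 k"
proof -
  have "v0 k \<notin> s03.span {v1 k}"
  proof
    assume "v0 k \<in> s03.span {v1 k}"
    then have "Dt * v0 k = s03_scale (-1) (v0 k)"
      by (rule LRR.act_eq_scale_on_span) (simp add: lrr_actions)
    then have "s03_scale (1 - (-1)) (v0 k) = 0"
      by (simp only: s03.scale_left_diff_distrib lrr_actions) simp
    then show False using v_nonzero[OF k] by simp
  qed
  then show "s03.independent {v0 k, v1 k}" "v0 k \<noteq> v1 k"
    using v_nonzero[OF k] by (auto simp: s03.independent_insert s03.dependent_single s03.span_base)
qed

text \<open>A nonzero invariant \<open>W\<close> contains the \<open>Dt\<close>-eigencomponents of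
  each of its elements, hence one of \<open>v0 k\<close>, \<open>v1 k\<close>; then
  \<open>Bt\<close> produces the other.\<close>

lemma irreducible_v:
  assumes k: "k \<in> {1, 2}"
  shows "LRR.irreducible (s03.span {v0 k, v1 k})"
proof -
  have "W = s03.span {v0 k, v1 k}"
    if W: "LRR.subrep W" "W \<subseteq> s03.span {v0 k, v1 k}" "W \<noteq> {0}" for W
  proof -
    have sub: "s03.subspace W" and closed: "\<And>a u. u \<in> W \<Longrightarrow> a * u \<in> W"
      using W(1) by (auto simp: LRR.subrep_def)
    from W(3) obtain w where w: "w \<in> W" "w \<noteq> 0"
      using s03.subspace_0[OF sub] by blast
    obtain a b where ab: "w = s03_scale a (v0 k) + s03_scale b (v1 k)"
    proof -
      have "w \<in> s03.span {v0 k, v1 k}" using W(2) w(1) by (rule subsetD)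
      then obtain a where "w - s03_scale a (v0 k) \<in> s03.span {v1 k}"
        by (auto simp only: s03.span_breakdown_eq)
      then obtain b where "w - s03_scale a (v0 k) = s03_scale b (v1 k)"
        by (auto simp: s03.span_singleton)
      then show ?thesis using that[of a b] by (simp add: diff_eq_eq add.commute)
    qed
    have Dw: "Dt * w = s03_scale a (v0 k) - s03_scale b (v1 k)"
      by (simp add: ab distrib_left s03.scale_mult_right lrr_actions)
    \<comment> \<open>The operators \<open>1 + Dt\<close> and \<open>1 - Dt\<close> isolate the two
      eigencomponents, each doubled.\<close>
    have "s03_scale (2 * a) (v0 k) = w + Dt * w" "s03_scale (2 * b) (v1 k) = w - Dt * w"
      unfolding Dw unfolding ab by (simp_all only: mult_2 s03.scale_left_distrib) simp_all
    then have "s03_scale (2 * a) (v0 k) \<in> W" "s03_scale (2 * b) (v1 k) \<in> W"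
      using s03.subspace_add[OF sub w(1) closed[OF w(1)]] s03.subspace_diff[OF sub w(1) closed[OF w(1)]]
      by simp_all
    then have "s03_scale (1 / (2 * a)) (s03_scale (2 * a) (v0 k)) \<in> W"
      "s03_scale (1 / (2 * b)) (s03_scale (2 * b) (v1 k)) \<in> W"
      by (simp_all only: s03.subspace_scale[OF sub])
    then have "a \<noteq> 0 \<Longrightarrow> v0 k \<in> W" "b \<noteq> 0 \<Longrightarrow> v1 k \<in> W"
      by simp_all
    moreover have "a \<noteq> 0 \<or> b \<noteq> 0"
      using w(2) by (auto simp: ab)
    ultimately have "v0 k \<in> W \<or> v1 k \<in> W" by blast
    then have "v0 k \<in> W" "v1 k \<in> W"
      using closed[of "v0 k" Bt] closed[of "v1 k" Bt] lrr_actions(1,2)[of k] by auto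
    then have "s03.span {v0 k, v1 k} \<subseteq> W"
      by (intro s03.span_minimal sub) simp
    with W(2) show ?thesis by (rule subset_antisym)
  qed
  moreover have "v0 k \<in> s03.span {v0 k, v1 k}" by (simp add: s03.span_base)
  with v_nonzero(1)[OF k] have "s03.span {v0 k, v1 k} \<noteq> {0}"
    by blast
  ultimately show ?thesis
    unfolding LRR.irreducible_def by (intro conjI allI impI subrep_irr2[unfolded irr2_def]) blast+
qed

text \<open>The sums and differences of \<open>v0 1\<close> with \<open>v1 2\<close> and of
  \<open>v1 1\<close> with \<open>v0 2\<close> are twice the four monomials.\<close>

lemma span_v:
  "s03.span {Dt, Dt^2, Bt * Dt, Dt * Ct} = s03.span (\<Union>k\<in>{1, 2}. {v0 k, v1 k})"
  unfolding s03.span_eq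
proof
  let ?S = "\<Union>k\<in>{1, 2}. {v0 k, v1 k}"
  have half: "x \<in> s03.span A" if "x + x \<in> s03.span A" for x A
  proof -
    have "s03_scale (1/2) (x + x) = x"
      using s03.scale_left_distrib[of "1/2" "1/2" x] by (simp add: s03.scale_right_distrib)
    then show ?thesis using s03.span_scale[OF that, of "1/2"] by simp
  qed
  have "v0 1 + v1 2 \<in> s03.span ?S" "v0 1 - v1 2 \<in> s03.span ?S"
    "v1 1 + v0 2 \<in> s03.span ?S" "v1 1 - v0 2 \<in> s03.span ?S"
    by (intro s03.span_add s03.span_diff s03.span_base; simp)+
  then show "{Dt, Dt^2, Bt * Dt, Dt * Ct} \<subseteq> s03.span ?S"
    by (auto simp: v0_def v1_def intro: half)
  show "?S \<subseteq> s03.span {Dt, Dt^2, Bt * Dt, Dt * Ct}"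
    by (auto simp: v0_def v1_def intro!: s03.span_add s03.span_diff intro: s03.span_base)
qed

lemma subrep_span_v: "LRR.subrep (s03.span {Dt, Dt^2, Bt * Dt, Dt * Ct})"
proof -
  define S where "S = (\<Union>k\<in>{1, 2}. {v0 k, v1 k})"
  have "LRR.subrep (s03.span S)"
  proof (rule s03_generator_invariant)
    fix x assume "x \<in> S"
    then obtain k where k: "k \<in> {1, 2}" and x: "x = v0 k \<or> x = v1 k"
      unfolding S_def by blast
    have "v0 k \<in> S" "v1 k \<in> S"
      using k unfolding S_def by blast+
    then have "v0 k \<in> s03.span S" "v1 k \<in> s03.span S"
      by (simp_all only: s03.span_base)
    then show "Bt * x \<in> s03.span S \<and> Ct * x \<in> s03.span S \<and> Dt * x \<in> s03.span S"
      using x by (elim disjE) (simp_all add: lrr_actions s03.span_neg)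
  qed
  then show ?thesis unfolding span_v S_def .
qed

text \<open>Right multiplication by \<open>Dt\<close> commutes with the left action and has eigenvalue \<open>1\<close> on the
  first summand and \<open>-1\<close> on the second, which gives the projections.\<close>

lemma direct_sum_v:
  "LRR.direct_sum {1, 2} (\<lambda>k. s03.span {v0 k, v1 k}) (s03.span {Dt, Dt^2, Bt * Dt, Dt * Ct})"
  unfolding span_v
proof (rule LRR.direct_sum_span_projections[where
      P = "\<lambda>k x. s03_scale (1/2) (if k = 1 then x + x * Dt else x - x * Dt)"])
  have half: "s03_scale (1/2) (x + x) = x" for x
    using s03.scale_left_distrib[of "1/2" "1/2" x] by (simp add: s03.scale_right_distrib)
  show "s03_scale (1/2) (if k = 1 then x + x * Dt else x - x * Dt) = x"
    if "k \<in> {1, 2}" "x \<in> {v0 k, v1 k}" for k :: nat and x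
    using that by (auto simp: v_right_Dt[unfolded One_nat_def] half)
  show "s03_scale (1/2) (if k = 1 then x + x * Dt else x - x * Dt) = 0"
    if "k \<in> {1, 2}" "l \<in> {1, 2}" "k \<noteq> l" "x \<in> {v0 l, v1 l}" for k l :: nat and x
    using that by (auto simp: v_right_Dt[unfolded One_nat_def])
qed (simp_all add: subrep_irr2[unfolded irr2_def] algebra_simps s03.scale_right_distrib
      s03.scale_right_diff_distrib s03.scale_mult_left mult.commute)

text \<open>Right multiplication commutes with the left regular action by associativity. The map is
  its own inverse between the two spans, so \<open>maps\<close> treats both directions at
  once.\<close>

lemma subrep_iso_v:
  "LRR.subrep_iso (\<lambda>x. - (x * Bt)) (s03.span {v0 1, v1 1}) (s03.span {v0 2, v1 2})"
proof -
  have maps: "- (x * Bt) \<in> s03.span {v0 l, v1 l} \<and> - (- (x * Bt) * Bt) = x"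
    if "x \<in> s03.span {v0 k, v1 k}" "(k, l) \<in> {(1, 2), (2, 1)}" for k l x
    using that(1)
  proof (induction rule: s03.span_induct_alt)
    case base
    show ?case by (simp add: s03.span_zero)
  next
    case (step c x y)
    have "- (x * Bt) \<in> s03.span {v0 l, v1 l}" "x * Bt * Bt = x"
      using step(1) that(2) by (auto simp: v_right_Bt[unfolded One_nat_def] s03.span_base)
    then have "s03_scale c (- (x * Bt)) + - (y * Bt) \<in> s03.span {v0 l, v1 l}"
      "x * Bt * Bt = x" "y * Bt * Bt = y"
      using step by (simp_all only: s03.span_add s03.span_scale mult_minus_left minus_minus)
    then show ?case by (simp add: distrib_right left_diff_distrib s03.scale_mult_left)
  qed
  have "bij_betw (\<lambda>x. - (x * Bt)) (s03.span {v0 1, v1 1}) (s03.span {v0 2, v1 2})"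
    by (rule bij_betw_byWitness[where f' = "\<lambda>x. - (x * Bt)"]) (use maps in blast)+
  then show ?thesis
    using subrep_irr2[unfolded irr2_def]
    by (simp add: LRR.subrep_iso_def distrib_right s03.scale_mult_left mult.assoc)
qed

section \<open>The trivial subrepresentation and the quotient\<close>

text \<open>The character sending all three generators to \<open>0\<close> takes the value
  \<open>-1\<close> here.\<close>

lemma Bt_sq_minus_one_nonzero: "Bt^2 - 1 \<noteq> 0"
proof
  assume eq: "Bt^2 - 1 = 0"
  obtain \<chi> :: "s03 \<Rightarrow> complex" where
    \<chi>: "\<forall>x y. \<chi> (x - y) = \<chi> x - \<chi> y" "\<forall>x y. \<chi> (x * y) = \<chi> x * \<chi> y" "\<chi> 1 = 1" "\<chi> Bt = 0"
    using s03_character[of 0 0] by auto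
  have "\<chi> (Bt^2 - 1) = -1"
    using \<chi> by (simp add: power2_eq_square)
  moreover have "\<chi> 0 = 0"
    using \<chi>(1)[rule_format, of 0 0] by simp
  ultimately show False using eq by simp
qed

lemma Quot_subrep_span:
  assumes "\<And>g x. g \<in> {Bt, Ct, Dt} \<Longrightarrow> x \<in> S \<Longrightarrow> quot_act g x \<in> Quot.span S"
  shows "Quot.subrep (Quot.span S)"
  by (rule subrep_span_if_generators[OF Quot.algebra_rep_axioms assms])

section \<open>Computing modulo \<open>sub5\<close>\<close>

lemma cls_eq_iff: "cls x = cls y \<longleftrightarrow> x - y \<in> sub5"
  by transfer simp

lemma cls_add: "cls (x + y) = cls x + cls y"
  by transfer (simp add: sub5_closed)

lemma cls_scale: "cls (s03_scale c x) = quot_scale c (cls x)"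
  by transfer (simp add: sub5_closed)

lemma quot_act_cls: "quot_act a (cls x) = cls (a * x)"
  by transfer (simp add: sub5_closed)

lemma cls_minus: "cls (- x) = - cls x"
  by transfer (simp add: sub5_closed)

lemma cls_diff: "cls (x - y) = cls x - cls y"
  by transfer (simp add: sub5_closed)

lemma cls_eq_0_iff: "cls x = 0 \<longleftrightarrow> x \<in> sub5"
  by transfer simp

lemma sub5_generators:
  "u \<in> s03.span {Dt, Dt^2, Bt * Dt, Dt * Ct} \<Longrightarrow> u \<in> sub5" "Bt^2 - 1 \<in> sub5"
proof -
  have 0: "0 \<in> irr2 k" "0 \<in> triv" for k
    by (simp_all add: irr2_def triv_def s03.span_zero)
  have "irr2 1 \<subseteq> sub5" "irr2 2 \<subseteq> sub5" "triv \<subseteq> sub5"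
    using 0 unfolding sub5_def by force+
  then have "(\<Union>k\<in>{1, 2}. {v0 k, v1 k}) \<subseteq> sub5" "Bt^2 - 1 \<in> sub5"
    unfolding irr2_def triv_def by (auto simp: subset_iff s03.span_base)
  then show "u \<in> s03.span {Dt, Dt^2, Bt * Dt, Dt * Ct} \<Longrightarrow> u \<in> sub5" "Bt^2 - 1 \<in> sub5"
    unfolding span_v using s03.span_minimal[OF _ sub5_subspace] by blast+
qed

text \<open>This is the table of left multiplication on the classes of \<open>1\<close>,
  \<open>Bt\<close>, \<open>Ct\<close>, \<open>Bt * Ct\<close>: they behave as if \<open>Bt\<close>
  and \<open>Ct\<close> commuted with squares \<open>1\<close> and \<open>-1\<close>, and
  \<open>Dt\<close> were zero.\<close>

lemma cls_relations:
  "cls (Bt * Bt) = cls 1" "cls (Ct * Bt) = cls (Bt * Ct)" "cls (Ct * Ct) = - cls 1"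
  "cls (Bt * (Bt * Ct)) = cls Ct" "cls (Ct * (Bt * Ct)) = - cls Bt"
  "cls Dt = 0" "cls (Dt * Bt) = 0" "cls (Dt * Ct) = 0" "cls (Dt * (Bt * Ct)) = 0"
proof -
  note rel = s03_relations[unfolded power2_eq_square power3_eq_cube]
  have CC: "Ct * Ct = - (Bt * Bt)" using rel(9) by (simp add: eq_neg_iff_add_eq_0 add.commute)
  have DB: "Dt * Bt = - (Bt * Dt)" using rel(5) by simp
  have CB: "Ct * Bt = Bt * Ct + (Dt + Dt)"
    using rel(4) by (simp add: algebra_simps mult_2)
  have D: "Dt \<in> sub5" and BD: "Bt * Dt \<in> sub5" and DC: "Dt * Ct \<in> sub5"
    by (rule sub5_generators(1), rule s03.span_base, simp)+
  show BB: "cls (Bt * Bt) = cls 1"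
    using sub5_generators(2) by (simp add: cls_eq_iff power2_eq_square)
  show "cls Dt = 0" "cls (Dt * Bt) = 0" "cls (Dt * Ct) = 0"
    using D BD DC by (simp_all add: cls_eq_0_iff DB sub5_closed(3))
  show "cls (Ct * Bt) = cls (Bt * Ct)"
    by (simp add: CB cls_add \<open>cls Dt = 0\<close>)
  show "cls (Ct * Ct) = - cls 1"
    by (simp add: CC cls_minus BB)
  \<comment> \<open>\<open>sub5\<close> is only known to absorb factors from the left, so
    \<open>Bt^2\<close> cannot be replaced by \<open>1\<close> in front of \<open>Ct\<close>.
    Instead \<open>Bt^2 = - Ct^2\<close> and \<open>Ct^3 = - Ct\<close> give the product
    exactly.\<close>
  have "Bt * (Bt * Ct) = - (Ct * Ct * Ct)"
    by (simp only: CC mult.assoc mult_minus_left minus_minus)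
  then show "cls (Bt * (Bt * Ct)) = cls Ct"
    by (simp add: rel(11))
  have "Ct * (Bt * Ct) = Bt * (Ct * Ct) + (Dt * Ct + Dt * Ct)"
    by (simp only: mult.assoc[symmetric] CB distrib_right)
  also have "Bt * (Ct * Ct) = - Bt"
    using rel(10) by (simp only: CC mult_minus_right mult.assoc)
  finally show "cls (Ct * (Bt * Ct)) = - cls Bt"
    by (simp add: cls_add cls_diff \<open>cls (Dt * Ct) = 0\<close>)
  have "Dt * (Bt * Ct) = - (Bt * (Dt * Ct))"
    by (simp only: mult.assoc[symmetric] DB mult_minus_left)
  then show "cls (Dt * (Bt * Ct)) = 0"
    using DC by (simp add: cls_eq_0_iff sub5_closed)
qed

lemma v_rep_actions:
  assumes "e \<in> {1, -1}" "e' \<in> {1, -1}"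
  shows "quot_act Bt (cls (v_rep e e')) = quot_scale e (cls (v_rep e e'))"
    "quot_act Ct (cls (v_rep e e')) = quot_scale (\<i> * e') (cls (v_rep e e'))"
    "quot_act Dt (cls (v_rep e e')) = 0"
proof -
  have ee: "e * e = 1" "e' * e' = 1" "e * (e * z) = z" "e' * (e' * z) = z" for z
    using assms by auto
  note expand = cls_add cls_diff cls_minus cls_scale cls_relations mult_1_right
    Quot.scale_right_distrib Quot.scale_right_diff_distrib Quot.scale_minus_right
    Quot.scale_scale Quot.scale_zero_right
  show "quot_act Bt (cls (v_rep e e')) = quot_scale e (cls (v_rep e e'))"
    unfolding v_rep_def quot_act_cls distrib_left right_diff_distrib s03.scale_mult_right
    by (simp only: expand) (simp add: ee mult.left_commute mult.commute)
  show "quot_act Ct (cls (v_rep e e')) = quot_scale (\<i> * e') (cls (v_rep e e'))"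
    unfolding v_rep_def quot_act_cls distrib_left right_diff_distrib s03.scale_mult_right
    by (simp only: expand) (simp add: ee mult.left_commute mult.commute)
  show "quot_act Dt (cls (v_rep e e')) = 0"
    unfolding v_rep_def quot_act_cls distrib_left right_diff_distrib s03.scale_mult_right
    by (simp only: expand) simp
qed

text \<open>The character with \<open>Bt\<close> sent to \<open>e\<close> and \<open>Ct\<close> to
  \<open>\<i> * e'\<close> vanishes on \<open>sub5\<close>, while each of the four terms of
  \<open>v_rep e e'\<close> contributes \<open>e\<close>.\<close>

lemma cls_v_rep_nonzero:
  assumes e: "e \<in> {1, -1}" and e': "e' \<in> {1, -1}"
  shows "cls (v_rep e e') \<noteq> 0"
proof -
  have "e^2 + (\<i> * e')^2 = 0" "e^3 = e" "(\<i> * e')^3 = - (\<i> * e')"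
    using e e' by (auto simp: power2_eq_square power3_eq_cube)
  from s03_character[OF this] obtain \<chi> :: "s03 \<Rightarrow> complex" where
    add: "\<forall>x y. \<chi> (x + y) = \<chi> x + \<chi> y" and diff: "\<forall>x y. \<chi> (x - y) = \<chi> x - \<chi> y"
    and mult: "\<forall>x y. \<chi> (x * y) = \<chi> x * \<chi> y"
    and scale: "\<forall>r x. \<chi> (s03_scale r x) = r * \<chi> x"
    and gens: "\<chi> 1 = 1" "\<chi> Bt = e" "\<chi> Ct = \<i> * e'" "\<chi> Dt = 0"
    by blast
  have \<chi>0: "\<chi> 0 = 0"
    using diff[rule_format, of 0 0] by simp
  have span: "\<chi> u = 0" if "u \<in> s03.span S" "\<And>x. x \<in> S \<Longrightarrow> \<chi> x = 0" for u S
    using that(1) by (induction rule: s03.span_induct_alt) (simp_all add: \<chi>0 add scale that(2))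
  \<comment> \<open>\<open>v0 k\<close> equals \<open>Dt * v0 k\<close>, so its value has the factor
    \<open>\<chi> Dt = 0\<close>.\<close>
  have "\<chi> (v0 k) = 0" for k
    using mult[rule_format, of Dt "v0 k"] by (simp add: lrr_actions gens)
  moreover from this have "\<chi> (v1 k) = 0" for k
    using mult[rule_format, of Bt "v0 k"] by (simp add: lrr_actions)
  moreover have "\<chi> (Bt^2 - 1) = 0"
    using e by (auto simp: power2_eq_square diff mult gens)
  ultimately have "u \<in> irr2 k \<Longrightarrow> \<chi> u = 0" "u \<in> triv \<Longrightarrow> \<chi> u = 0" for u k
    using span[of u "{v0 k, v1 k}"] span[of u "{Bt^2 - 1}"] unfolding irr2_def triv_def by blast+
  then have "\<chi> u = 0" if "u \<in> sub5" for u
    using that unfolding sub5_def by (auto simp: add)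
  moreover have "\<chi> (v_rep e e') = 4 * e"
    using e e' by (auto simp: v_rep_def add diff scale mult gens)
  ultimately show ?thesis
    using e by (auto simp: cls_eq_0_iff)
qed

section \<open>Splitting the quotient into joint eigenlines\<close>

definition quot_proj :: "complex \<times> complex \<Rightarrow> s03" where
  "quot_proj p = s03_scale (1/4)
    ((1 + s03_scale (fst p) Bt) * (1 - s03_scale (\<i> * snd p) Ct))"

text \<open>Up to a factor 2 each, the two factors project onto the eigenvalue \<open>e\<close> of
  \<open>Bt\<close> and \<open>\<i> * e'\<close> of \<open>Ct\<close>. When \<open>e\<close> and
  \<open>e'\<close> are signs as well, the resulting scalar is \<open>1\<close> if both pairs agree
  and \<open>0\<close> otherwise.\<close>

lemma quot_proj_v_rep:
  assumes "f \<in> {1, -1}" "f' \<in> {1, -1}"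
  shows "quot_act (quot_proj (e, e')) (cls (v_rep f f')) =
    quot_scale ((1 + e * f) * (1 + e' * f') / 4) (cls (v_rep f f'))"
proof -
  let ?v = "cls (v_rep f f')"
  have "quot_act (1 - s03_scale (\<i> * e') Ct) ?v = quot_scale (1 + e' * f') ?v"
  proof -
    have "\<i> * e' * (\<i> * f') = \<i> * \<i> * (e' * f')" by (simp only: mult_ac)
    then have "\<i> * e' * (\<i> * f') = - (e' * f')" by simp
    then show ?thesis
      by (simp only: Quot.act_diff_left Quot.act_one Quot.act_scale_left v_rep_actions[OF assms]
          Quot.scale_scale Quot.scale_left_distrib Quot.scale_minus_left Quot.scale_one
          diff_minus_eq_add)
  qed
  moreover have "quot_act (1 + s03_scale e Bt) ?v = quot_scale (1 + e * f) ?v"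
    by (simp add: Quot.act_add_left Quot.act_one Quot.act_scale_left v_rep_actions[OF assms]
        Quot.scale_left_distrib)
  ultimately show ?thesis
    by (simp add: quot_proj_def Quot.act_scale_left Quot.act_mult Quot.act_scale_right mult.commute)
qed

text \<open>A general \<open>P\<close> covers both the single lines and the span of all
  four.\<close>

lemma subrep_span_v_rep:
  assumes "P \<subseteq> {1, -1} \<times> {1, -1}"
  shows "Quot.subrep (Quot.span (\<Union>p\<in>P. {cls (v_rep (fst p) (snd p))}))"
proof (rule Quot_subrep_span)
  let ?S = "\<Union>p\<in>P. {cls (v_rep (fst p) (snd p))}"
  fix g x assume g: "g \<in> {Bt, Ct, Dt}" and x: "x \<in> ?S"
  then obtain p where "p \<in> P" and x_eq: "x = cls (v_rep (fst p) (snd p))" by blast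
  then have p: "fst p \<in> {1, -1}" "snd p \<in> {1, -1}"
    using assms by (simp_all only: subset_iff mem_Times_iff)
  have "x \<in> Quot.span ?S"
    using x by (rule Quot.span_base)
  then show "quot_act g x \<in> Quot.span ?S"
    using g unfolding x_eq
    by (elim insertE emptyE) (simp_all only: v_rep_actions[OF p] Quot.span_scale Quot.span_zero)
qed

text \<open>The class of \<open>1\<close> generates the quotient under the action, so it suffices
  that this invariant span contains it.\<close>

lemma span_v_rep:
  "Quot.span (\<Union>p\<in>{1, -1} \<times> {1, -1}. {cls (v_rep (fst p) (snd p))}) = UNIV"
proof -
  define S where "S = (\<Union>p\<in>{1, -1} \<times> {1, -1}. {cls (v_rep (fst p) (snd p))})"
  have "cls (v_rep e e') \<in> S" if "e \<in> {1, -1}" "e' \<in> {1, -1}" for e e'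
    using that unfolding S_def by force
  then have "cls (v_rep 1 1) + cls (v_rep 1 (-1)) - cls (v_rep (-1) 1) - cls (v_rep (-1) (-1))
      \<in> Quot.span S"
    by (intro Quot.span_add Quot.span_diff Quot.span_base) simp_all
  \<comment> \<open>Weighting each vector by its \<open>e\<close> cancels the terms in
    \<open>Bt\<close>, \<open>Ct\<close> and \<open>Bt * Ct\<close> and leaves four copies of
    \<open>1\<close>.\<close>
  moreover have "v_rep 1 1 + v_rep 1 (-1) - v_rep (-1) 1 - v_rep (-1) (-1) = s03_scale 4 1"
    using s03.scale_left_distrib[of 2 2 1] s03.scale_left_distrib[of 1 1 1]
    by (simp add: v_rep_def)
  ultimately have "quot_scale 4 (cls 1) \<in> Quot.span S"
    by (simp flip: cls_add cls_diff cls_scale)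
  then have one: "cls 1 \<in> Quot.span S"
    using Quot.span_scale[of "quot_scale 4 (cls 1)" S "1/4"] by simp
  have "q \<in> Quot.span S" for q
  proof -
    obtain x where "q = cls x"
      using Quotient_abs_rep[OF Quotient_lrr_quot] cls.abs_eq by metis
    then have "q = quot_act x (cls 1)" by (simp add: quot_act_cls)
    then show ?thesis
      using subrep_span_v_rep[of "{1, -1} \<times> {1, -1}"] one
      unfolding S_def[symmetric] Quot.subrep_def by blast
  qed
  then show ?thesis unfolding S_def by blast
qed

lemma direct_sum_v_rep:
  "Quot.direct_sum ({1, -1} \<times> {1, -1}) (\<lambda>(e, e'). Quot.span {cls (v_rep e e')}) UNIV"
proof -
  have "Quot.direct_sum ({1, -1} \<times> {1, -1}) (\<lambda>p. Quot.span {cls (v_rep (fst p) (snd p))})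
      (Quot.span (\<Union>p\<in>{1, -1} \<times> {1, -1}. {cls (v_rep (fst p) (snd p))}))"
  proof (rule Quot.direct_sum_span_projections[where P = "\<lambda>p. quot_act (quot_proj p)"])
    show "Quot.subrep (Quot.span {cls (v_rep (fst p) (snd p))})" if "p \<in> {1, -1} \<times> {1, -1}" for p
      using subrep_span_v_rep[of "{p}"] that by simp
    show "quot_act (quot_proj p) x = x"
      if "p \<in> {1, -1} \<times> {1, -1}" "x \<in> {cls (v_rep (fst p) (snd p))}" for p x
      using that quot_proj_v_rep[of "fst p" "snd p" "fst p" "snd p"] by auto
    show "quot_act (quot_proj p) x = 0"
      if "p \<in> {1, -1} \<times> {1, -1}" "p' \<in> {1, -1} \<times> {1, -1}" "p \<noteq> p'"
        "x \<in> {cls (v_rep (fst p') (snd p'))}" for p p' x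
      using that quot_proj_v_rep[of "fst p'" "snd p'" "fst p" "snd p"] by auto
  qed (simp_all add: Quot.act_add_right Quot.act_scale_right)
  moreover have "(\<lambda>(e, e'). Quot.span {cls (v_rep e e')}) =
      (\<lambda>p. Quot.span {cls (v_rep (fst p) (snd p))})"
    by auto
  ultimately show ?thesis by (simp only: span_v_rep)
qed

lemma span_v_rep_actions:
  assumes "e \<in> {1, -1}" "e' \<in> {1, -1}" "q \<in> Quot.span {cls (v_rep e e')}"
  shows "quot_act Bt q = quot_scale e q" "quot_act Ct q = quot_scale (\<i> * e') q"
    "quot_act (Bt^2) q = q" "quot_act (Dt^2) q = 0"
proof -
  note q = Quot.act_eq_scale_on_span[OF assms(3)]
  show B: "quot_act Bt q = quot_scale e q" and "quot_act Ct q = quot_scale (\<i> * e') q"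
    by (rule q; simp add: v_rep_actions[OF assms(1,2)])+
  have D: "quot_act Dt q = quot_scale 0 q"
    by (rule q) (simp add: v_rep_actions[OF assms(1,2)])
  show "quot_act (Bt^2) q = q" "quot_act (Dt^2) q = 0"
    using assms(1) by (auto simp: power2_eq_square Quot.act_mult B D Quot.act_scale_right)
qed

text \<open>Distinct sign pairs differ in the eigenvalue of \<open>Bt\<close> or in that of
  \<open>Ct\<close>.\<close>

lemma v_rep_not_isomorphic:
  assumes p: "p \<in> {1, -1} \<times> {1, -1}" and p': "p' \<in> {1, -1} \<times> {1, -1}" and "p \<noteq> p'"
  shows "\<not> Quot.isomorphic (Quot.span {cls (v_rep (fst p) (snd p))})
    (Quot.span {cls (v_rep (fst p') (snd p'))})"
proof -
  have e: "fst p \<in> {1, -1}" "snd p \<in> {1, -1}" and e': "fst p' \<in> {1, -1}" "snd p' \<in> {1, -1}"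
    using p p' by auto
  have v: "cls (v_rep (fst p) (snd p)) \<in> Quot.span {cls (v_rep (fst p) (snd p))}"
    by (simp add: Quot.span_base)
  note not_iso = Quot.not_isomorphic_if_eigenvalue_neq[OF cls_v_rep_nonzero[OF e] v]
  consider "fst p \<noteq> fst p'" | "\<i> * snd p \<noteq> \<i> * snd p'"
    using \<open>p \<noteq> p'\<close> by (auto simp: prod_eq_iff)
  then show ?thesis
  proof cases
    case 1
    show ?thesis
      by (rule not_iso[OF v_rep_actions(1)[OF e] span_v_rep_actions(1)[OF e'] 1])
  next
    case 2
    show ?thesis
      by (rule not_iso[OF v_rep_actions(2)[OF e] span_v_rep_actions(2)[OF e'] 2])
  qed
qed

section \<open>Remaining actions and dimensions, and assembly of the three claims\<close>

lemma span_v_squares: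
  assumes "u \<in> s03.span {v0 k, v1 k}"
  shows "Bt^2 * u = u" "Dt^2 * u = u"
proof -
  have "Bt^2 * u = s03_scale 1 u" "Dt^2 * u = s03_scale 1 u"
    by (rule LRR.act_eq_scale_on_span[OF assms];
        auto simp: power2_eq_square mult.assoc lrr_actions)+
  then show "Bt^2 * u = u" "Dt^2 * u = u" by simp_all
qed

lemma triv_actions:
  assumes "u \<in> s03.span {Bt^2 - 1}"
  shows "Bt * u = 0" "Ct * u = 0" "Dt * u = 0"
proof -
  have "Bt * u = s03_scale 0 u" "Ct * u = s03_scale 0 u" "Dt * u = s03_scale 0 u"
    by (rule LRR.act_eq_scale_on_span[OF assms]; simp add: lrr_actions)+
  then show "Bt * u = 0" "Ct * u = 0" "Dt * u = 0" by simp_all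
qed

lemma dim_v:
  assumes "k \<in> {1, 2}"
  shows "s03.dim (s03.span {v0 k, v1 k}) = 2"
  using independent_v[OF assms] s03.dim_span_eq_card_independent[of "{v0 k, v1 k}"] by simp

theorem mainTheorem4:
  shows
    "(LRR.subrep (s03.span {Dt, Dt^2, Bt * Dt, Dt * Ct})
     \<and> LRR.direct_sum {1, 2} (\<lambda>k. s03.span {v0 k, v1 k}) (s03.span {Dt, Dt^2, Bt * Dt, Dt * Ct})
     \<and> (\<forall>k\<in>{1, 2}.
          LRR.irreducible (s03.span {v0 k, v1 k})
        \<and> s03.dim (s03.span {v0 k, v1 k}) = 2
        \<and> Bt * v0 k = v1 k \<and> Bt * v1 k = v0 k
        \<and> Ct * v0 k = - v1 k \<and> Ct * v1 k = v0 k
        \<and> Dt * v0 k = v0 k \<and> Dt * v1 k = - v1 k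
        \<and> (\<forall>u \<in> s03.span {v0 k, v1 k}. Bt^2 * u = u \<and> Dt^2 * u = u))
     \<and> (\<exists>f. LRR.subrep_iso f (s03.span {v0 1, v1 1}) (s03.span {v0 2, v1 2})
          \<and> f (v0 1) = v0 2 \<and> f (v1 1) = v1 2))
   \<and>
     (LRR.subrep (s03.span {Bt^2 - 1})
     \<and> s03.dim (s03.span {Bt^2 - 1}) = 1
     \<and> (\<forall>u \<in> s03.span {Bt^2 - 1}. Bt * u = 0 \<and> Ct * u = 0 \<and> Dt * u = 0))
   \<and>
     (Quot.direct_sum ({1, -1} \<times> {1, -1}) (\<lambda>(e, e'). Quot.span {cls (v_rep e e')}) UNIV
     \<and> (\<forall>e\<in>{1, -1}. \<forall>e'\<in>{1, -1}.
          Quot.dim (Quot.span {cls (v_rep e e')}) = 1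
        \<and> quot_act Bt (cls (v_rep e e')) = quot_scale e (cls (v_rep e e'))
        \<and> quot_act Ct (cls (v_rep e e')) = quot_scale (\<i> * e') (cls (v_rep e e'))
        \<and> quot_act Dt (cls (v_rep e e')) = 0
        \<and> (\<forall>q \<in> Quot.span {cls (v_rep e e')}. quot_act (Bt^2) q = q \<and> quot_act (Dt^2) q = 0))
     \<and> (\<forall>p\<in>{1, -1} \<times> {1, -1}. \<forall>p'\<in>{1, -1} \<times> {1, -1}. p \<noteq> p' \<longrightarrow>
          \<not> Quot.isomorphic (Quot.span {cls (v_rep (fst p) (snd p))})
                             (Quot.span {cls (v_rep (fst p') (snd p'))})))"
proof -
  \<comment> \<open>The witness for the isomorphism is right multiplication by \<open>- Bt\<close>;
    these are its values on the basis.\<close>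
  have "- (v0 1 * Bt) = v0 2" "- (v1 1 * Bt) = v1 2"
    by (simp_all only: v_right_Bt minus_minus)
  with subrep_iso_v have iso: "\<exists>f. LRR.subrep_iso f (s03.span {v0 1, v1 1}) (s03.span {v0 2, v1 2})
      \<and> f (v0 1) = v0 2 \<and> f (v1 1) = v1 2"
    by blast
  show ?thesis
    by (intro conjI ballI impI subrep_span_v direct_sum_v irreducible_v dim_v lrr_actions
        span_v_squares iso subrep_triv[unfolded triv_def]
        s03.dim_span_singleton[OF Bt_sq_minus_one_nonzero] triv_actions
        direct_sum_v_rep Quot.dim_span_singleton cls_v_rep_nonzero v_rep_actions
        span_v_rep_actions v_rep_not_isomorphic; assumption)
qed

end
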